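(* Let $(\Sigma)$: $\dot g=\mathcal X(g)+\sum_{i=1}^m u_iB_i(g)$ be a linear system on the generalized Heisenberg group $\mathbb{H}^n$, with $B_1,\dots,B_m$ linearly independent and $[B_i,B_k]=0$ for all $1\le i,k\le m$, and let $(X_1,Y_1,\dots,X_n,Y_n,Z)$ be a symplectic basis of $\mathfrak h^n$ such that $X_i=B_i$ for $i=1,\dots,m$ (with $m\le n$). Assume that $(\Sigma)$ satisfies the rank condition. Let $1\le j\le m$. If the $j$-th cell is decoupled, and if the restriction $(\Sigma_j)$ is controllable on $G_j$, then $(\Sigma)$ is controllable on $\mathbb{H}^n$.
   Context: $\mathbb{H}^n$ is the $(2n+1)$-dimensional simply connected Lie group of real $(n+2)\times(n+2)$ upper triangular matrices with ones on the diagonal, first row $(1,y_1,\dots,y_n,z)$, last column $(z,x_1,\dots,x_n,1)^T$, and all other off-diagonal entries $0$. Its Lie algebra $\mathfrak h^n$ (the right-invariant vector fields) has basis $X_i=\partial/\partial x_i$, $Y_i=\partial/\partial y_i+x_i\,\partial/\partial z$ $(1\le i\le n)$, $Z=\partial/\partial z$, with $[X_i,Y_i]=Z$ and all other brackets zero. A basis $(X_1,Y_1,\dots,X_n,Y_n,Z)$ of $\mathfrak h^n$ (with $Z$ any generator of the center) is symplectic if $[X_i,Y_i]=Z$ for all $i$ and all other brackets of basis elements vanish. A vector field $\mathcal X$ on a connected Lie group $G$ is linear if its flow is a one-parameter group of automorphisms of $G$; the associated derivation of the Lie algebra $\mathfrak g$ (of right-invariant vector fields) is $D=-\mathrm{ad}(\mathcal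 X)$. A linear system is a control system $\dot g=\mathcal X(g)+\sum_{j=1}^m u_jB_j(g)$ with $\mathcal X$ linear, the $B_j$ right-invariant, and inputs $u=(u_1,\dots,u_m)$ measurable, locally bounded, with values in $\mathbb R^m$. It is controllable if for all $g,h\in G$ some input steers $g$ to $h$ in some time $T\ge 0$. It satisfies the rank condition if the Lie subalgebra of $\mathfrak g$ generated by $\{D^kB_j:\ k\in\mathbb N,\ 1\le j\le m\}$ is equal to $\mathfrak g$. For $j\le m$, the $j$-th cell is the subspace $\mathrm{Span}\{B_j,Y_j\}$; it is decoupled if $\mathrm{Span}\{B_j,Y_j,Z\}$ is invariant by $D$. In that case $G_j$ denotes the connected Lie subgroup of $\mathbb H^n$ with Lie algebra $\mathrm{Span}\{B_j,Y_j,Z\}$ (it is invariant under the flow of $\mathcal X$), and $(\Sigma_j)$ denotes the restriction of $(\Sigma)$ to $G_j$, i.e. the one-input linear system $\dot g=\mathcal X(g)+u_jB_j(g)$ on $G_j$. *)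

theory Defs
  imports
    "HOL-Analysis.Analysis"
    "HOL-Algebra.Generated_Groups"
    "HOL-Library.Function_Algebras"
begin

section \<open>The generalized Heisenberg group\<close>

text \<open>
  A point \<open>(x, y, z)\<close> stands for the unipotent matrix with first row \<open>(1, y, z)\<close> and last column
  \<open>(z, x, 1)\<close>; the rank \<open>n\<close> is \<open>CARD('n)\<close>. The group law in these global coordinates is matrix
  multiplication, see \<open>heis_matrix_mult\<close>.
\<close>

type_synonym 'n heis = "(real ^ 'n) \<times> (real ^ 'n) \<times> real"

fun hmult :: "'n::finite heis \<Rightarrow> 'n heis \<Rightarrow> 'n heis" where
  "hmult (x, y, z) (x', y', z') = (x + x', y + y', z + z' + y \<bullet> x')"

definition heis_group :: "('n::finite heis) monoid" where
  "heis_group = \<lparr>carrier = UNIV, monoid.mult = hmult, one = 0\<rparr>"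

lemma group_heis_group: "group (heis_group :: ('n::finite heis) monoid)"
proof (rule groupI)
  fix g :: "'n heis"
  obtain x y z where g: "g = (x, y, z)" by (cases g)
  have "hmult (- x, - y, y \<bullet> x - z) g = 0"
    by (simp add: g zero_prod_def)
  then show "\<exists>h\<in>carrier heis_group. h \<otimes>\<^bsub>heis_group\<^esub> g = \<one>\<^bsub>heis_group\<^esub>"
    by (auto simp: heis_group_def)
qed (auto simp: heis_group_def zero_prod_def inner_simps)

text \<open>Rows and columns are indexed by first index, middle indices, last index.\<close>

type_synonym 'n heis_index = "unit + 'n + unit"

fun heis_matrix :: "'n::finite heis \<Rightarrow> real ^ 'n heis_index ^ 'n heis_index" where
  "heis_matrix (x, y, z) = (\<chi> r c.
     case r of
       Inl _ \<Rightarrow> (case c of Inl _ \<Rightarrow> 1 | Inr (Inl k) \<Rightarrow> y $ k | Inr (Inr _) \<Rightarrow> z)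
     | Inr (Inl i) \<Rightarrow> (case c of Inl _ \<Rightarrow> 0 | Inr (Inl k) \<Rightarrow> (if i = k then 1 else 0) | Inr (Inr _) \<Rightarrow> x $ i)
     | Inr (Inr _) \<Rightarrow> (case c of Inl _ \<Rightarrow> 0 | Inr (Inl _) \<Rightarrow> 0 | Inr (Inr _) \<Rightarrow> 1))"

lemma sum_heis_index:
  fixes f :: "'n::finite heis_index \<Rightarrow> real"
  shows "sum f UNIV = f (Inl ()) + (\<Sum>i\<in>UNIV. f (Inr (Inl i))) + f (Inr (Inr ()))"
proof -
  have "sum f UNIV = sum f (range Inl) + sum f (range Inr)"
    unfolding UNIV_sum by (rule sum.union_disjoint) auto
  also have "sum f (range Inl) = f (Inl ())"
    by (simp add: UNIV_unit)
  also have "sum f (range Inr) = (\<Sum>k\<in>UNIV. f (Inr k))"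
    by (simp add: sum.reindex)
  also have "(\<Sum>k\<in>UNIV. f (Inr k)) = (\<Sum>k\<in>range Inl. f (Inr k)) + (\<Sum>k\<in>range Inr. f (Inr k))"
    unfolding UNIV_sum by (rule sum.union_disjoint) auto
  also have "\<dots> = (\<Sum>i\<in>UNIV. f (Inr (Inl i))) + f (Inr (Inr ()))"
    by (simp add: sum.reindex UNIV_unit)
  finally show ?thesis by simp
qed

lemma heis_matrix_mult: "heis_matrix (hmult g h) = heis_matrix g ** heis_matrix h"
proof -
  obtain x y z where g: "g = (x, y, z)" by (cases g)
  obtain x' y' z' where h: "h = (x', y', z')" by (cases h)
  have "heis_matrix (hmult g h) $ r $ c = (heis_matrix g ** heis_matrix h) $ r $ c" for r c
    by (auto simp: g h matrix_matrix_mult_def sum_heis_index inner_vec_def if_distrib if_distribR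
             cong: if_cong split: sum.splits)
  then show ?thesis by (simp add: vec_eq_iff)
qed

lemma inj_heis_matrix: "inj heis_matrix"
proof (rule injI)
  fix g h :: "'n::finite heis"
  assume eq: "heis_matrix g = heis_matrix h"
  obtain x y z where g: "g = (x, y, z)" by (cases g)
  obtain x' y' z' where h: "h = (x', y', z')" by (cases h)
  have *: "heis_matrix g $ r $ c = heis_matrix h $ r $ c" for r c
    using eq by simp
  have "x $ i = x' $ i" "y $ i = y' $ i" "z = z'" for i
    using *[of "Inr (Inl i)" "Inr (Inr ())"] *[of "Inl ()" "Inr (Inl i)"] *[of "Inl ()" "Inr (Inr ())"]
    by (simp_all add: g h)
  then show "g = h" by (simp add: g h vec_eq_iff)
qed


section \<open>Vector fields and the Lie algebra\<close>

instantiation "fun" :: (type, real_vector) real_vector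
begin

definition scaleR_fun :: "real \<Rightarrow> ('a \<Rightarrow> 'b) \<Rightarrow> 'a \<Rightarrow> 'b" where
  "scaleR_fun c f = (\<lambda>x. c *\<^sub>R f x)"

instance
  by standard (auto simp: scaleR_fun_def fun_eq_iff scaleR_add_right scaleR_add_left)

end

lemma scaleR_fun_apply [simp]: "(c *\<^sub>R f) x = c *\<^sub>R f x"
  by (simp add: scaleR_fun_def)

primrec ck :: "nat \<Rightarrow> ('a::real_normed_vector \<Rightarrow> 'b::real_normed_vector) \<Rightarrow> bool" where
  "ck 0 = (\<lambda>f. continuous_on UNIV f)"
| "ck (Suc k) = (\<lambda>f. (\<forall>x. f differentiable at x) \<and> (\<forall>v. ck k (\<lambda>x. frechet_derivative f (at x) v)))"

definition smooth :: "('a::real_normed_vector \<Rightarrow> 'b::real_normed_vector) \<Rightarrow> bool" where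
  "smooth f \<longleftrightarrow> (\<forall>k. ck k f)"

type_synonym 'n vfield = "'n heis \<Rightarrow> 'n heis"

text \<open>Coordinates of \<open>[V, W] f = V (W f) - W (V f)\<close>.\<close>

definition lie_bracket :: "'n::finite vfield \<Rightarrow> 'n vfield \<Rightarrow> 'n vfield" where
  "lie_bracket V W = (\<lambda>g. frechet_derivative W (at g) (V g) - frechet_derivative V (at g) (W g))"

definition right_invariant :: "'n::finite vfield \<Rightarrow> bool" where
  "right_invariant V \<longleftrightarrow>
     (\<forall>h g. V (hmult h g) = frechet_derivative (\<lambda>k. hmult k g) (at h) (V h))"

definition heis_algebra :: "('n::finite vfield) set" where
  "heis_algebra = {V. right_invariant V}"

lemma frechet_derivative_right_translation:
  "frechet_derivative (\<lambda>k. hmult k (x', y', z')) (at h) = (\<lambda>(a, b, c). (a, b, c + b \<bullet> x'))"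
proof -
  have "((\<lambda>k. (fst k + x', fst (snd k) + y', snd (snd k) + z' + fst (snd k) \<bullet> x')) has_derivative
         (\<lambda>v. (fst v, fst (snd v), snd (snd v) + fst (snd v) \<bullet> x'))) (at h)"
    by (auto intro!: derivative_eq_intros)
  moreover have "(\<lambda>k. hmult k (x', y', z'))
      = (\<lambda>k. (fst k + x', fst (snd k) + y', snd (snd k) + z' + fst (snd k) \<bullet> x'))"
    by (auto simp: fun_eq_iff)
  ultimately show ?thesis
    by (simp add: frechet_derivative_at[symmetric] case_prod_beta')
qed

text \<open>
  So \<open>heis_algebra\<close> is spanned by \<open>\<partial>/\<partial>x\<^sub>i\<close>, \<open>\<partial>/\<partial>y\<^sub>i + x\<^sub>i \<partial>/\<partial>z\<close> and \<open>\<partial>/\<partial>z\<close>: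
\<close>

lemma right_invariant_iff:
  "right_invariant V \<longleftrightarrow> (\<exists>a b c. V = (\<lambda>(x, y, z). (a, b, c + b \<bullet> x)))"
proof
  assume R: "right_invariant V"
  obtain a b c where V0: "V (0, 0, 0) = (a, b, c)" by (cases "V (0, 0, 0)")
  have "V (x, y, z) = (a, b, c + b \<bullet> x)" for x y z
    using R[unfolded right_invariant_def, rule_format, of "(0, 0, 0)" "(x, y, z)"]
    by (simp add: frechet_derivative_right_translation V0)
  then show "\<exists>a b c. V = (\<lambda>(x, y, z). (a, b, c + b \<bullet> x))"
    by (auto simp: fun_eq_iff)
next
  assume "\<exists>a b c. V = (\<lambda>(x, y, z). (a, b, c + b \<bullet> x))"
  then show "right_invariant V"
    by (auto simp: right_invariant_def frechet_derivative_right_translation inner_simps)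
qed

definition heis_center :: "('n::finite vfield) set" where
  "heis_center = {V \<in> heis_algebra. \<forall>W\<in>heis_algebra. lie_bracket V W = 0}"

definition lie_subalgebra :: "('n::finite vfield) set \<Rightarrow> bool" where
  "lie_subalgebra L \<longleftrightarrow> L \<subseteq> heis_algebra \<and> subspace L \<and> (\<forall>V\<in>L. \<forall>W\<in>L. lie_bracket V W \<in> L)"

definition lie_basis :: "('n::finite vfield) list \<Rightarrow> bool" where
  "lie_basis bs \<longleftrightarrow> distinct bs \<and> independent (set bs) \<and> span (set bs) = heis_algebra"

definition symplectic_basis ::
    "(nat \<Rightarrow> 'n::finite vfield) \<Rightarrow> (nat \<Rightarrow> 'n vfield) \<Rightarrow> 'n vfield \<Rightarrow> bool" where
  "symplectic_basis X Y Z \<longleftrightarrow>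
     lie_basis (map X [1..<CARD('n) + 1] @ map Y [1..<CARD('n) + 1] @ [Z]) \<and>
     span {Z} = heis_center \<and>
     (\<forall>i\<in>{1..CARD('n)}. \<forall>k\<in>{1..CARD('n)}.
        lie_bracket (X i) (X k) = 0 \<and> lie_bracket (Y i) (Y k) = 0 \<and>
        lie_bracket (X i) (Y k) = (if i = k then Z else 0)) \<and>
     (\<forall>i\<in>{1..CARD('n)}. lie_bracket (X i) Z = 0 \<and> lie_bracket (Y i) Z = 0)"

text \<open>
  The connected Lie subgroup with Lie algebra \<open>L\<close> is the subgroup generated by \<open>exp L\<close>;
  \<open>exp V\<close> is the time-one value of the integral curve of \<open>V\<close> issued from the identity.
\<close>

definition exp_image :: "('n::finite vfield) set \<Rightarrow> ('n heis) set" where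
  "exp_image L = {\<gamma> 1 | \<gamma> V. V \<in> L \<and> \<gamma> 0 = \<one>\<^bsub>heis_group\<^esub> \<and>
     (\<forall>t::real. (\<gamma> has_vector_derivative V (\<gamma> t)) (at t))}"

definition connected_subgroup :: "('n::finite vfield) set \<Rightarrow> ('n heis) set" where
  "connected_subgroup L = generate heis_group (exp_image L)"


section \<open>Linear systems\<close>

definition heis_automorphism :: "('n::finite heis \<Rightarrow> 'n heis) \<Rightarrow> bool" where
  "heis_automorphism f \<longleftrightarrow>
     f \<in> iso heis_group heis_group \<and> smooth f \<and> smooth (inv_into UNIV f)"

definition is_flow :: "'n::finite vfield \<Rightarrow> (real \<Rightarrow> 'n heis \<Rightarrow> 'n heis) \<Rightarrow> bool" where
  "is_flow V \<phi> \<longleftrightarrow>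
     (\<forall>g. \<phi> 0 g = g \<and> (\<forall>t. ((\<lambda>s. \<phi> s g) has_vector_derivative V (\<phi> t g)) (at t)))"

definition linear_vfield :: "'n::finite vfield \<Rightarrow> bool" where
  "linear_vfield V \<longleftrightarrow> smooth V \<and>
     (\<exists>\<phi>. is_flow V \<phi> \<and> (\<forall>s t. \<phi> (s + t) = \<phi> s \<circ> \<phi> t) \<and> (\<forall>t. heis_automorphism (\<phi> t)))"

definition derivation_of :: "'n::finite vfield \<Rightarrow> 'n vfield \<Rightarrow> 'n vfield" where
  "derivation_of V W = - lie_bracket V W"

definition linear_system :: "'n::finite vfield \<Rightarrow> nat set \<Rightarrow> (nat \<Rightarrow> 'n vfield) \<Rightarrow> bool" where
  "linear_system V I B \<longleftrightarrow> finite I \<and> linear_vfield V \<and> (\<forall>i\<in>I. B i \<in> heis_algebra)"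

definition admissible_input :: "nat set \<Rightarrow> (real \<Rightarrow> nat \<Rightarrow> real) \<Rightarrow> bool" where
  "admissible_input I u \<longleftrightarrow> (\<forall>i\<in>I.
     (\<lambda>t. u t i) \<in> borel_measurable (lebesgue_on {0..}) \<and>
     (\<forall>T. bounded ((\<lambda>t. u t i) ` {0..T})))"

text \<open>
  Caratheodory solutions, in integral form. For a continuous \<open>\<gamma>\<close> and an admissible input the
  integrand is bounded and measurable, so this integral is the Lebesgue integral.
\<close>

definition trajectory ::
    "'n::finite vfield \<Rightarrow> nat set \<Rightarrow> (nat \<Rightarrow> 'n vfield) \<Rightarrow> (real \<Rightarrow> nat \<Rightarrow> real) \<Rightarrow> real
      \<Rightarrow> (real \<Rightarrow> 'n heis) \<Rightarrow> bool" where
  "trajectory V I B u T \<gamma> \<longleftrightarrow> continuous_on {0..T} \<gamma> \<and>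
     (\<forall>t\<in>{0..T}. ((\<lambda>s. V (\<gamma> s) + (\<Sum>i\<in>I. u s i *\<^sub>R B i (\<gamma> s))) has_integral (\<gamma> t - \<gamma> 0)) {0..t})"

text \<open>Controllability of the restriction of the system to the invariant subset \<open>M\<close>.\<close>

definition controllable_on ::
    "('n::finite heis) set \<Rightarrow> 'n vfield \<Rightarrow> nat set \<Rightarrow> (nat \<Rightarrow> 'n vfield) \<Rightarrow> bool" where
  "controllable_on M V I B \<longleftrightarrow> (\<forall>g\<in>M. \<forall>h\<in>M. \<exists>T\<ge>0. \<exists>u \<gamma>.
     admissible_input I u \<and> trajectory V I B u T \<gamma> \<and> \<gamma> ` {0..T} \<subseteq> M \<and> \<gamma> 0 = g \<and> \<gamma> T = h)"

definition rank_condition :: "'n::finite vfield \<Rightarrow> nat set \<Rightarrow> (nat \<Rightarrow> 'n vfield) \<Rightarrow> bool" where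
  "rank_condition V I B \<longleftrightarrow>
     lie_subalgebra hull {(derivation_of V ^^ k) (B i) | k i. i \<in> I} = heis_algebra"

text \<open>\<open>W\<^sub>1\<close> and \<open>W\<^sub>2\<close> span the cell.\<close>

definition decoupled_cell :: "'n::finite vfield \<Rightarrow> 'n vfield \<Rightarrow> 'n vfield \<Rightarrow> 'n vfield \<Rightarrow> bool" where
  "decoupled_cell V W\<^sub>1 W\<^sub>2 Z \<longleftrightarrow> derivation_of V ` span {W\<^sub>1, W\<^sub>2, Z} \<subseteq> span {W\<^sub>1, W\<^sub>2, Z}"

end

theory Submission
  imports Defs
begin

text \<open>
  The quotient of the Heisenberg group by its center is the additive group of pairs \<open>(x, y)\<close>. A
  linear vector field \<open>V\<close> descends to this quotient as a linear map \<open>A\<close>, and right-invariant fields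
  descend to constant fields, so the system projects to an ordinary linear control system
  \<open>\<xi>' = A \<xi> + \<Sum>i. u\<^sub>i b\<^sub>i\<close>. The derivation of \<open>V\<close> projects to \<open>A\<close> and all brackets of
  right-invariant fields are central, hence the rank condition projects to the Kalman condition: the
  vectors \<open>A\<^sup>k b\<^sub>i\<close> span the quotient. The projected system is therefore controllable.

  Lifting a steering input of the quotient, any \<open>g\<close> can be brought into the center, the fibre over
  \<open>0\<close>. For the way from the center to a prescribed \<open>h\<close>, note that along a lifted trajectory the
  central coordinate solves a scalar affine equation \<open>z' = d z + F t\<close>. With the
  input held fixed, its final value is thus an affine bijection of its initial value, so some point of the
  center is steered to \<open>h\<close>. These two facts are \<open>rank_condition_imp_steering_between_fibres\<close>.

  What remains is to move inside the center from the first point to the second. The center lies in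
  \<open>G\<^sub>j\<close>, because \<open>Z\<close>, which spans the central fields, belongs to its Lie algebra, and a
  trajectory of \<open>\<Sigma>\<^sub>j\<close> is a trajectory of \<open>\<Sigma>\<close> whose other inputs vanish; so controllability of
  \<open>\<Sigma>\<^sub>j\<close> supplies the middle piece. Concatenating the three pieces (\<open>steers_trans\<close>) proves the
  theorem.
\<close>

section \<open>Steering linear control systems\<close>

text \<open>
  Additivity gives homogeneity for rational scalars; the scalars for which homogeneity holds form
  a closed set, so density of \<open>\<rat>\<close> gives all of them.
\<close>

lemma additive_continuous_imp_linear:
  fixes f :: "'a::real_normed_vector \<Rightarrow> 'b::real_normed_vector"
  assumes cont: "continuous_on UNIV f" and add: "\<And>x y. f (x + y) = f x + f y"
  shows "linear f"
proof (rule linearI)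
  fix r :: real and x
  have f0: "f 0 = 0"
    using add[of 0 0] by simp
  have nat: "f (real n *\<^sub>R y) = real n *\<^sub>R f y" for n y
    by (induction n) (simp_all add: f0 add scaleR_add_left)
  have neg: "f (- y) = - f y" for y
    using minus_unique[of "f y" "f (- y)"] add[of y "- y"] f0 by simp
  have int: "f (of_int k *\<^sub>R y) = of_int k *\<^sub>R f y" for k y
    by (cases k rule: int_cases2) (simp_all add: nat neg)
  have rat: "f (q *\<^sub>R x) = q *\<^sub>R f x" if "q \<in> \<rat>" for q
  proof -
    obtain a b where q: "q = of_int a / of_int b" "b > 0"
      using \<open>q \<in> \<rat>\<close> by (auto elim: Rats_cases')
    have "of_int b *\<^sub>R f (q *\<^sub>R x) = f (of_int a *\<^sub>R x)"
      using q int[of b "q *\<^sub>R x"] by simp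
    also have "\<dots> = of_int b *\<^sub>R (q *\<^sub>R f x)"
      using q by (simp add: int)
    finally show ?thesis
      by (rule scaleR_left_imp_eq[rotated]) (use q in simp)
  qed
  have "continuous_on UNIV (\<lambda>r. f (r *\<^sub>R x))"
    by (rule continuous_on_compose2[OF cont]) (auto intro!: continuous_intros)
  then have "closed {r. f (r *\<^sub>R x) = r *\<^sub>R f x}"
    by (intro closed_Collect_eq) (auto intro!: continuous_intros)
  moreover have "\<rat> \<subseteq> {r. f (r *\<^sub>R x) = r *\<^sub>R f x}"
    using rat by blast
  ultimately have "closure \<rat> \<subseteq> {r. f (r *\<^sub>R x) = r *\<^sub>R f x}"
    by (rule closure_minimal[rotated])
  then show "f (r *\<^sub>R x) = r *\<^sub>R f x"
    unfolding Rats_closure_real by blast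
qed (fact add)

text \<open>
  The map sending \<open>p\<close> to the integral is the controllability Gramian. Pairing it with \<open>p\<close> gives
  \<open>\<integral> \<Sum>i. (p \<bullet> c i s)\<^sup>2 ds\<close>, so it is positive definite under the nondegeneracy hypothesis, hence
  injective, hence onto.
\<close>

lemma gramian_surjective:
  fixes c :: "'i \<Rightarrow> real \<Rightarrow> 'a::euclidean_space"
  assumes fin: "finite I" and cont: "\<And>i. i \<in> I \<Longrightarrow> continuous_on {0..1} (c i)"
    and nondeg: "\<And>p. (\<forall>i\<in>I. \<forall>s\<in>{0..1}. p \<bullet> c i s = 0) \<Longrightarrow> p = 0"
  obtains p where "integral {0..1} (\<lambda>s. \<Sum>i\<in>I. (p \<bullet> c i s) *\<^sub>R c i s) = w"
proof -
  define G where "G p = integral {0..1} (\<lambda>s. \<Sum>i\<in>I. (p \<bullet> c i s) *\<^sub>R c i s)" for p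
  have int: "(\<lambda>s. \<Sum>i\<in>I. (p \<bullet> c i s) *\<^sub>R c i s) integrable_on {0..1}" for p
    by (intro integrable_continuous_interval continuous_intros cont)
  have "linear G"
  proof (rule linearI)
    show "G (p + q) = G p + G q" for p q
      unfolding G_def
      by (subst integral_add[OF int int, symmetric])
        (simp add: inner_add_left scaleR_add_left sum.distrib)
    show "G (r *\<^sub>R p) = r *\<^sub>R G p" for r p
      unfolding G_def by (subst integral_cmul[symmetric]) (simp add: scaleR_sum_right)
  qed
  moreover have "inj G"
  proof (subst linear_injective_0[OF \<open>linear G\<close>], intro allI impI)
    fix p assume "G p = 0"
    have "integral {0..1} (\<lambda>s. \<Sum>i\<in>I. (p \<bullet> c i s)\<^sup>2) = p \<bullet> G p"
      unfolding G_def
      by (subst integral_linear[OF int bounded_linear_inner_right[of p], symmetric])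
        (simp add: o_def inner_sum_right power2_eq_square)
    also have "\<dots> = 0" by (simp add: \<open>G p = 0\<close>)
    finally have "integral {0..1} (\<lambda>s. \<Sum>i\<in>I. (p \<bullet> c i s)\<^sup>2) = 0" .
    moreover have "continuous_on {0..1} (\<lambda>s. \<Sum>i\<in>I. (p \<bullet> c i s)\<^sup>2)"
      by (intro continuous_intros cont)
    ultimately have "\<forall>s\<in>{0..1}. (\<Sum>i\<in>I. (p \<bullet> c i s)\<^sup>2) = 0"
      by (subst (asm) integral_eq_0_iff) (auto intro: sum_nonneg)
    then have "\<forall>i\<in>I. \<forall>s\<in>{0..1}. p \<bullet> c i s = 0"
      using fin by (simp add: sum_nonneg_eq_0_iff)
    then show "p = 0" by (rule nondeg)
  qed
  ultimately have "surj G"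
    by (rule linear_inj_imp_surj)
  then obtain p where "G p = w" unfolding surj_def by metis
  then show ?thesis unfolding G_def by (rule that)
qed

text \<open>
  Here \<open>\<Psi> t\<close> is the flow \<open>exp (t A)\<close>, given by its characteristic properties. By variation of
  constants \<open>x t = \<Psi> t (v + \<integral> \<Psi> (- s) (\<Sum>i. u\<^sub>i b\<^sub>i) ds)\<close>, so steering \<open>v\<close> to \<open>w\<close> means that the integral
  over the unit interval has the value \<open>\<Psi> (- 1) w - v\<close>; an input \<open>u\<^sub>i s = p \<bullet> \<Psi> (- s) b\<^sub>i\<close> achieves this
  by the Gramian argument. The Gramian is nondegenerate since a \<open>p\<close> orthogonal to all curves
  \<open>\<Psi> (- s) b\<^sub>i\<close> is orthogonal to all \<open>A\<^sup>k b\<^sub>i\<close>, by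
  repeated differentiation on the unit interval and evaluation at \<open>s = 0\<close>.
\<close>

lemma kalman_steering:
  fixes A :: "'a::euclidean_space \<Rightarrow> 'a" and \<Psi> :: "real \<Rightarrow> 'a \<Rightarrow> 'a"
  assumes linA: "linear A" and lin\<Psi>: "\<And>t. linear (\<Psi> t)"
    and \<Psi>0: "\<And>v. \<Psi> 0 v = v" and \<Psi>add: "\<And>s t v. \<Psi> (s + t) v = \<Psi> s (\<Psi> t v)"
    and \<Psi>': "\<And>t v. ((\<lambda>t. \<Psi> t v) has_vector_derivative A (\<Psi> t v)) (at t)"
    and fin: "finite I"
    and kalman: "span {(A ^^ k) (b i) | k i. i \<in> I} = UNIV"
  obtains u x where "\<forall>i. continuous_on UNIV (\<lambda>t. u t i)" "x 0 = v" "x 1 = w"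
    "\<forall>t\<in>{0..1}. (x has_vector_derivative A (x t) + (\<Sum>i\<in>I. u t i *\<^sub>R b i)) (at t within {0..1})"
proof -
  define c where "c i s = \<Psi> (- s) (b i)" for i s
  have cont\<Psi>: "continuous_on S (\<lambda>t. \<Psi> t y)" for S y
    by (rule continuous_at_imp_continuous_on)
      (use \<Psi>' in \<open>auto intro: has_vector_derivative_continuous\<close>)
  have contc: "continuous_on S (c i)" for S i
    unfolding c_def by (rule continuous_on_compose2[OF cont\<Psi>[of UNIV]]) (auto intro!: continuous_intros)
  have c': "((\<lambda>s. p \<bullet> (A ^^ k) (c i s)) has_vector_derivative - (p \<bullet> (A ^^ Suc k) (c i s))) (at s)"
    for p k i s
  proof -
    have lin: "linear ((A ^^ k))"
      using linear_compose[OF _ linA] by (induction k) (auto simp: linear_id)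
    have "((\<lambda>t. \<Psi> t (b i)) \<circ> uminus has_vector_derivative (- 1) *\<^sub>R A (c i s)) (at s)"
      unfolding c_def
      by (rule vector_diff_chain_at) (use \<Psi>' in \<open>auto intro!: derivative_eq_intros\<close>)
    then have "(c i has_vector_derivative - A (c i s)) (at s)"
      by (simp add: o_def c_def[abs_def])
    from bounded_linear.has_vector_derivative[OF
        bounded_linear_compose[OF bounded_linear_inner_right[of p] linear_conv_bounded_linear[THEN iffD1, OF lin]] this]
    show ?thesis
      by (simp add: linear_neg[OF lin] funpow_swap1)
  qed
  have nondeg: "p = 0" if p: "\<forall>i\<in>I. \<forall>s\<in>{0..1}. p \<bullet> c i s = 0" for p
  proof -
    have "p \<bullet> (A ^^ k) (c i s) = 0" if "i \<in> I" "s \<in> {0..1}" for i k s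
      using that(2)
    proof (induction k arbitrary: s)
      case 0
      then show ?case using p \<open>i \<in> I\<close> by simp
    next
      case (Suc k)
      have "((\<lambda>s. p \<bullet> (A ^^ k) (c i s)) has_vector_derivative 0) (at s within {0..1})"
        by (rule has_vector_derivative_transform[where f = "\<lambda>_. 0"]) (use Suc in auto)
      moreover have "((\<lambda>s. p \<bullet> (A ^^ k) (c i s)) has_vector_derivative
          - (p \<bullet> (A ^^ Suc k) (c i s))) (at s within {0..1})"
        by (rule has_vector_derivative_at_within) (rule c')
      ultimately have "0 = - (p \<bullet> (A ^^ Suc k) (c i s))"
        using Suc.prems by (intro vector_derivative_unique_within_closed_interval[of 0 1 s]) auto
      then show ?case by simp
    qed
    from this[of _ 0] have orth: "orthogonal p y" if "y \<in> {(A ^^ k) (b i) | k i. i \<in> I}" for y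
      using that by (auto simp: orthogonal_def c_def \<Psi>0)
    have "p \<in> span {(A ^^ k) (b i) | k i. i \<in> I}"
      by (simp only: kalman UNIV_I)
    then have "orthogonal p p"
      using orth by (rule orthogonal_to_span)
    then show "p = 0" by (simp add: orthogonal_self)
  qed
  obtain p where p: "integral {0..1} (\<lambda>s. \<Sum>i\<in>I. (p \<bullet> c i s) *\<^sub>R c i s) = \<Psi> (- 1) w - v"
    by (rule gramian_surjective[OF fin contc nondeg])
  define u where "u s i = p \<bullet> c i s" for s i
  define F where "F s = (\<Sum>i\<in>I. u s i *\<^sub>R c i s)" for s
  define \<xi> where "\<xi> t = v + integral {0..t} F" for t
  define x where "x t = \<Psi> t (\<xi> t)" for t
  have inv: "\<Psi> t (\<Psi> (- t) y) = y" for t y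
    using \<Psi>add[of t "- t" y] by (simp add: \<Psi>0)
  show ?thesis
  proof (intro that allI ballI)
    show "continuous_on UNIV (\<lambda>t. u t i)" for i
      unfolding u_def by (intro continuous_intros contc)
    show "x 0 = v" by (simp add: x_def \<xi>_def \<Psi>0)
    show "x 1 = w" using p by (simp add: x_def \<xi>_def F_def[abs_def] u_def inv)
    fix t :: real assume t: "t \<in> {0..1}"
    have "continuous_on {0..1} F"
      unfolding F_def u_def by (intro continuous_intros contc)
    then have \<xi>': "(\<xi> has_vector_derivative F t) (at t within {0..1})"
      unfolding \<xi>_def using integral_has_vector_derivative[of 0 1 F t] t
      by (auto intro!: derivative_eq_intros)
    \<comment> \<open>Expanding in a basis reduces the derivative of \<open>\<Psi> t (\<xi> t)\<close> to the product rule for a scalar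
        factor times a curve \<open>\<Psi> t e\<close> with fixed \<open>e\<close>.\<close>
    have expand: "L y = (\<Sum>e\<in>Basis. (y \<bullet> e) *\<^sub>R L e)" if "linear L" for L :: "'a \<Rightarrow> 'a" and y
      using linear_sum[OF that, of "\<lambda>e. (y \<bullet> e) *\<^sub>R e" Basis]
      by (simp add: euclidean_representation linear_scale[OF that])
    have x_eq: "x = (\<lambda>t. \<Sum>e\<in>Basis. (\<xi> t \<bullet> e) *\<^sub>R \<Psi> t e)"
      unfolding x_def by (intro ext expand lin\<Psi>)
    have "(x has_vector_derivative (\<Sum>e\<in>Basis. (\<xi> t \<bullet> e) *\<^sub>R A (\<Psi> t e) + (F t \<bullet> e) *\<^sub>R \<Psi> t e))
        (at t within {0..1})"
      unfolding x_eq
      by (intro has_vector_derivative_sum has_vector_derivative_scaleR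
          has_vector_derivative_at_within[OF \<Psi>']
          bounded_linear.has_vector_derivative[OF bounded_linear_inner_left \<xi>', THEN
            has_real_derivative_iff_has_vector_derivative[THEN iffD2]])
    also have "(\<Sum>e\<in>Basis. (\<xi> t \<bullet> e) *\<^sub>R A (\<Psi> t e) + (F t \<bullet> e) *\<^sub>R \<Psi> t e) = A (x t) + \<Psi> t (F t)"
      using expand[OF linear_compose[OF lin\<Psi> linA], of t "\<xi> t"] expand[OF lin\<Psi>, of t "F t"]
      by (simp add: sum.distrib x_def)
    also have "\<Psi> t (F t) = (\<Sum>i\<in>I. u t i *\<^sub>R b i)"
      by (simp add: F_def linear_sum[OF lin\<Psi>] linear_scale[OF lin\<Psi>] c_def inv)
    finally show "(x has_vector_derivative A (x t) + (\<Sum>i\<in>I. u t i *\<^sub>R b i)) (at t within {0..1})" .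
  qed
qed

text \<open>
  The constant \<open>C\<close> does not depend on the initial value: the endpoint map is an affine bijection of
  the line, which allows the final value to be prescribed by adjusting the initial one.
\<close>

lemma scalar_affine_ode:
  fixes F :: "real \<Rightarrow> real"
  assumes "continuous_on {0..1} F"
  obtains C where "\<forall>z\<^sub>0. \<exists>z. z 0 = z\<^sub>0 \<and> z 1 = exp d * (z\<^sub>0 + C) \<and>
    (\<forall>t\<in>{0..1}. (z has_vector_derivative d * z t + F t) (at t within {0..1}))"
proof -
  define K where "K t = integral {0..t} (\<lambda>s. exp (- d * s) * F s)" for t
  have "continuous_on {0..1} (\<lambda>s. exp (- d * s) * F s)"
    by (intro continuous_intros assms)
  then have K': "(K has_real_derivative exp (- d * t) * F t) (at t within {0..1})"
    if "t \<in> {0..1}" for t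
    unfolding K_def using that by (rule integral_has_real_derivative)
  have "((\<lambda>t. exp (d * t) * (z\<^sub>0 + K t)) has_vector_derivative
      d * (exp (d * t) * (z\<^sub>0 + K t)) + F t) (at t within {0..1})" if "t \<in> {0..1}" for t z\<^sub>0
  proof -
    have "((\<lambda>t. exp (d * t) * (z\<^sub>0 + K t)) has_real_derivative
      exp (d * t) * d * (z\<^sub>0 + K t) + exp (d * t) * (exp (- d * t) * F t)) (at t within {0..1})"
      by (auto intro!: derivative_eq_intros K' that)
    moreover have "exp (d * t) * d * (z\<^sub>0 + K t) + exp (d * t) * (exp (- d * t) * F t) =
        d * (exp (d * t) * (z\<^sub>0 + K t)) + F t"
      by (simp add: exp_minus)
    ultimately show ?thesis
      unfolding has_real_derivative_iff_has_vector_derivative by metis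
  qed
  moreover have "exp (d * 0) * (z\<^sub>0 + K 0) = z\<^sub>0" "exp (d * 1) * (z\<^sub>0 + K 1) = exp d * (z\<^sub>0 + K 1)" for z\<^sub>0
    by (simp_all add: K_def)
  ultimately have "\<exists>z. z 0 = z\<^sub>0 \<and> z 1 = exp d * (z\<^sub>0 + K 1) \<and>
      (\<forall>t\<in>{0..1}. (z has_vector_derivative d * z t + F t) (at t within {0..1}))" for z\<^sub>0
    by (intro exI[of _ "\<lambda>t. exp (d * t) * (z\<^sub>0 + K t)"] conjI ballI)
  then show ?thesis by (intro that[of "K 1"] allI)
qed

section \<open>The quotient by the center\<close>

definition hproj :: "'n::finite heis \<Rightarrow> (real ^ 'n) \<times> (real ^ 'n)" where
  "hproj g = (fst g, fst (snd g))"

definition hpoint :: "(real ^ 'n) \<times> (real ^ 'n) \<Rightarrow> real \<Rightarrow> 'n::finite heis" where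
  "hpoint v z = (fst v, snd v, z)"

lemma hproj_hpoint [simp]: "hproj (hpoint v z) = v"
  by (simp add: hproj_def hpoint_def)

lemma zcoord_hpoint [simp]: "snd (snd (hpoint v z)) = z"
  by (simp add: hpoint_def)

lemma hpoint_hproj: "hpoint (hproj g) (snd (snd g)) = g"
  by (simp add: hproj_def hpoint_def)

lemma bounded_linear_hproj: "bounded_linear hproj"
  unfolding hproj_def
  by (intro bounded_linear_Pair bounded_linear_fst bounded_linear_compose[OF bounded_linear_fst bounded_linear_snd])

lemma hproj_hmult: "hproj (hmult g h) = hproj g + hproj h"
  by (cases g; cases h) (simp add: hproj_def)

lemma hmult_conv:
  "hmult g h = hpoint (hproj g + hproj h)
     (snd (snd g) + snd (snd h) + fst (snd g) \<bullet> fst h)"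
  by (cases g; cases h) (simp add: hpoint_def hproj_def)

text \<open>
  Every central element is a commutator, so a homomorphism into a vector space kills the center. This
  lemma serves twice: for the horizontal part of a linear vector field and for that of its flow.
\<close>

lemma continuous_homomorphism_factors_hproj:
  fixes P :: "'n::finite heis \<Rightarrow> 'b::real_normed_vector"
  assumes cont: "continuous_on UNIV P" and hom: "\<And>g h. P (hmult g h) = P g + P h"
  obtains L where "linear L" "\<forall>g. P g = L (hproj g)"
proof -
  have center: "P (0, 0, z) = 0" for z
  proof -
    define e :: "real ^ 'n" where "e = axis undefined 1"
    have e: "e \<bullet> e = 1" by (simp add: e_def inner_axis_axis)
    \<comment> \<open>\<open>(0, 0, z)\<close> is the commutator of \<open>(0, e, 0)\<close> and \<open>(z e, 0, 0)\<close>, written without inverses.\<close>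
    have "P (hmult (hmult (z *\<^sub>R e, 0, 0) (0, e, 0)) (0, 0, z)) = P (hmult (0, e, 0) (z *\<^sub>R e, 0, 0))"
      by (simp add: e)
    then show ?thesis unfolding hom by simp
  qed
  define L where "L v = P (hpoint v 0)" for v
  have P_eq: "P g = L (hproj g)" for g
    using hom[of "hpoint (hproj g) 0" "(0, 0, snd (snd g))"] center
    by (cases g) (simp add: L_def hpoint_def hproj_def)
  have "linear L"
  proof (rule additive_continuous_imp_linear)
    show "continuous_on UNIV L"
      unfolding L_def hpoint_def
      by (rule continuous_on_compose2[OF cont]) (auto intro!: continuous_intros)
    show "L (v + w) = L v + L w" for v w
      using hom[of "hpoint v 0" "hpoint w 0"] by (simp add: P_eq hproj_hmult)
  qed
  then show ?thesis using P_eq by (intro that allI)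
qed

section \<open>Linear vector fields in coordinates\<close>

lemma has_vector_derivative_hmult:
  fixes \<gamma> \<delta> :: "real \<Rightarrow> 'n::finite heis"
  assumes \<gamma>: "(\<gamma> has_vector_derivative (a, b, c)) (at t)"
    and \<delta>: "(\<delta> has_vector_derivative (a', b', c')) (at t)"
    and at: "\<gamma> t = (x, y, z)" "\<delta> t = (x', y', z')"
  shows "((\<lambda>s. hmult (\<gamma> s) (\<delta> s)) has_vector_derivative
    (a + a', b + b', c + c' + b \<bullet> x' + y \<bullet> a')) (at t)"
proof -
  have comp: "((\<lambda>s. fst (\<epsilon> s)) has_vector_derivative p) (at t)"
    "((\<lambda>s. fst (snd (\<epsilon> s))) has_vector_derivative q) (at t)"
    "((\<lambda>s. snd (snd (\<epsilon> s))) has_vector_derivative r) (at t)"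
    if "(\<epsilon> has_vector_derivative (p, q, r)) (at t)"
    for \<epsilon> :: "real \<Rightarrow> 'n heis" and p q r
    using bounded_linear.has_vector_derivative[OF bounded_linear_fst that]
      bounded_linear.has_vector_derivative[OF bounded_linear_snd that]
      bounded_linear.has_vector_derivative[OF bounded_linear_compose[OF bounded_linear_fst bounded_linear_snd] that]
      bounded_linear.has_vector_derivative[OF bounded_linear_compose[OF bounded_linear_snd bounded_linear_snd] that]
    by simp_all
  have eq: "(\<lambda>s. hmult (\<gamma> s) (\<delta> s)) = (\<lambda>s. (fst (\<gamma> s) + fst (\<delta> s), fst (snd (\<gamma> s)) + fst (snd (\<delta> s)),
      snd (snd (\<gamma> s)) + snd (snd (\<delta> s)) + fst (snd (\<gamma> s)) \<bullet> fst (\<delta> s)))"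
    by (simp add: hmult_conv hpoint_def hproj_def)
  note inner = bounded_bilinear.has_vector_derivative[OF bounded_bilinear_inner comp(2)[OF \<gamma>] comp(1)[OF \<delta>]]
  show ?thesis
    unfolding eq
    by (rule has_vector_derivative_eq_rhs,
        rule has_vector_derivative_Pair[OF has_vector_derivative_add[OF comp(1)[OF \<gamma>] comp(1)[OF \<delta>]]
          has_vector_derivative_Pair[OF has_vector_derivative_add[OF comp(2)[OF \<gamma>] comp(2)[OF \<delta>]]
          has_vector_derivative_add[OF has_vector_derivative_add[OF comp(3)[OF \<gamma>] comp(3)[OF \<delta>]] inner]]])
      (simp add: at)
qed

lemma smooth_imp_differentiable: "smooth f \<Longrightarrow> f differentiable at x"
  unfolding smooth_def by (drule spec[of _ 1]) simp

lemma smooth_imp_continuous: "smooth f \<Longrightarrow> continuous_on S f"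
  by (simp add: smooth_imp_differentiable differentiable_imp_continuous_on differentiable_on_def
      differentiable_at_withinI)

text \<open>
  Differentiating \<open>\<phi>\<^sub>t (g h) = \<phi>\<^sub>t g \<cdot> \<phi>\<^sub>t h\<close> at \<open>t = 0\<close> gives a product rule for \<open>V\<close> (the step
  \<open>V_hmult\<close>). Its horizontal part says that \<open>hproj \<circ> V\<close> is a homomorphism, which yields \<open>A\<close>; evaluated
  with a central second factor, it says that the vertical part depends on \<open>z\<close> only through an additive
  term, which yields \<open>d\<close>. The projected flow \<open>\<Psi>\<close> is the flow of \<open>A\<close>, so no matrix
  exponential has to be constructed.
\<close>

lemma linear_vfield_structure:
  fixes V :: "'n::finite vfield"
  assumes "linear_vfield V"
  obtains A d \<Psi> where
    "linear A" "\<forall>g. hproj (V g) = A (hproj g)"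
    "\<forall>v z. snd (snd (V (hpoint v z))) = snd (snd (V (hpoint v 0))) + d * z"
    "\<forall>t. linear (\<Psi> t)" "\<forall>v. \<Psi> 0 v = v" "\<forall>s t v. \<Psi> (s + t) v = \<Psi> s (\<Psi> t v)"
    "\<forall>t v. ((\<lambda>t. \<Psi> t v) has_vector_derivative A (\<Psi> t v)) (at t)"
proof -
  obtain \<phi> where smV: "smooth V" and flow: "is_flow V \<phi>"
    and grp: "\<And>s t. \<phi> (s + t) = \<phi> s \<circ> \<phi> t" and auto: "\<And>t. heis_automorphism (\<phi> t)"
    using assms unfolding linear_vfield_def by blast
  have \<phi>0: "\<phi> 0 g = g" and \<phi>': "((\<lambda>s. \<phi> s g) has_vector_derivative V (\<phi> t g)) (at t)" for t g
    using flow unfolding is_flow_def by blast+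
  have \<phi>_hom: "\<phi> t (hmult g h) = hmult (\<phi> t g) (\<phi> t h)" for t g h
    using auto[of t] unfolding heis_automorphism_def iso_def hom_def heis_group_def
    by (simp del: split_paired_All)
  have V_hmult: "V (hmult (x, y, z) (x', y', z')) = (a + a', b + b', c + c' + b \<bullet> x' + y \<bullet> a')"
    if "V (x, y, z) = (a, b, c)" "V (x', y', z') = (a', b', c')" for x y z x' y' z' a b c a' b' c'
  proof (rule vector_derivative_unique_at)
    show "((\<lambda>s. \<phi> s (hmult (x, y, z) (x', y', z'))) has_vector_derivative
        V (hmult (x, y, z) (x', y', z'))) (at 0)"
      using \<phi>'[of "hmult (x, y, z) (x', y', z')" 0] by (simp only: \<phi>0)
    show "((\<lambda>s. \<phi> s (hmult (x, y, z) (x', y', z'))) has_vector_derivative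
        (a + a', b + b', c + c' + b \<bullet> x' + y \<bullet> a')) (at 0)"
      unfolding \<phi>_hom
      by (rule has_vector_derivative_hmult)
        (use \<phi>'[of "(x, y, z)" 0] \<phi>'[of "(x', y', z')" 0] that in \<open>simp_all add: \<phi>0\<close>)
  qed
  have cont_hproj: "continuous_on UNIV (\<lambda>g. hproj (f g))" if "smooth f" for f :: "'n vfield"
    using bounded_linear.continuous_on[OF bounded_linear_hproj smooth_imp_continuous[OF that]] .
  have "hproj (V (hmult g h)) = hproj (V g) + hproj (V h)" for g h
    by (cases g; cases h; cases "V g"; cases "V h") (simp only: V_hmult, simp add: hproj_def)
  then obtain A where "linear A" "\<forall>g. hproj (V g) = A (hproj g)"
    by (rule continuous_homomorphism_factors_hproj[OF cont_hproj[OF smV]])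
  then have A: "linear A" "\<And>g. hproj (V g) = A (hproj g)"
    by blast+
  have "\<exists>L. linear L \<and> (\<forall>g. hproj (\<phi> t g) = L (hproj g))" for t
  proof -
    have "continuous_on UNIV (\<lambda>g. hproj (\<phi> t g))"
      using auto[of t] by (intro cont_hproj) (simp add: heis_automorphism_def)
    moreover have "hproj (\<phi> t (hmult g h)) = hproj (\<phi> t g) + hproj (\<phi> t h)" for g h
      by (simp add: \<phi>_hom hproj_hmult)
    ultimately obtain L where "linear L" "\<forall>g. hproj (\<phi> t g) = L (hproj g)"
      by (rule continuous_homomorphism_factors_hproj)
    then show ?thesis by blast
  qed
  then obtain \<Psi> where \<Psi>: "\<And>t. linear (\<Psi> t)" "\<And>t g. hproj (\<phi> t g) = \<Psi> t (hproj g)"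
    by metis
  define d where "d = snd (snd (V (hpoint 0 1)))"
  have zcoord: "snd (snd (V (hpoint v z))) = snd (snd (V (hpoint v 0))) + snd (snd (V (hpoint 0 z)))" for v z
  proof -
    have "hproj (V (0, 0, z)) = 0"
      using A linear_0[OF A(1)] by (simp add: hproj_def zero_prod_def)
    then obtain c where "V (0, 0, z) = (0, 0, c)"
      by (cases "V (0, 0, z)") (simp add: hproj_def zero_prod_def)
    then show ?thesis
      using V_hmult[of "fst v" "snd v" 0 _ _ _ 0 0 z 0 0 c]
      by (cases "V (fst v, snd v, 0)") (simp add: hpoint_def)
  qed
  have lin: "linear (\<lambda>z. snd (snd (V (hpoint 0 z))))"
  proof (rule additive_continuous_imp_linear)
    show "continuous_on UNIV (\<lambda>z. snd (snd (V (hpoint 0 z))))"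
      unfolding hpoint_def
      by (intro continuous_on_snd continuous_on_compose2[OF smooth_imp_continuous[OF smV, of UNIV]])
        (auto intro!: continuous_intros)
    fix z w :: real
    obtain a b c where V: "V (0, 0, z) = (a, b, c)" by (cases "V (0, 0, z)")
    obtain a' b' c' where V': "V (0, 0, w) = (a', b', c')" by (cases "V (0, 0, w)")
    show "snd (snd (V (hpoint 0 (z + w)))) = snd (snd (V (hpoint 0 z))) + snd (snd (V (hpoint 0 w)))"
      using V_hmult[OF V V'] by (simp add: hpoint_def V V')
  qed
  have d: "snd (snd (V (hpoint 0 z))) = d * z" for z
    using linear_scale[OF lin, of z 1] by (simp add: d_def)
  show ?thesis
  proof (intro that[of A d \<Psi>] allI)
    show "snd (snd (V (hpoint v z))) = snd (snd (V (hpoint v 0))) + d * z" for v z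
      by (simp only: zcoord[of v z] d)
    show "\<Psi> 0 v = v" for v
      using \<Psi>(2)[of 0 "hpoint v 0"] by (simp add: \<phi>0)
    show "\<Psi> (s + t) v = \<Psi> s (\<Psi> t v)" for s t v
      using \<Psi>(2)[of "s + t" "hpoint v 0"] by (simp add: grp \<Psi>(2))
    show "((\<lambda>t. \<Psi> t v) has_vector_derivative A (\<Psi> t v)) (at t)" for t v
      using bounded_linear.has_vector_derivative[OF bounded_linear_hproj \<phi>'[of "hpoint v 0" t]]
      by (simp add: \<Psi>(2) A(2))
  qed (fact A \<Psi>(1))+
qed

section \<open>Right-invariant fields and the rank condition\<close>

definition rinv :: "real ^ 'n \<Rightarrow> real ^ 'n \<Rightarrow> real \<Rightarrow> 'n::finite vfield" where
  "rinv a b c = (\<lambda>g. (a, b, c + b \<bullet> fst g))"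

lemma heis_algebra_iff: "W \<in> heis_algebra \<longleftrightarrow> (\<exists>a b c. W = rinv a b c)"
  by (simp add: heis_algebra_def right_invariant_iff rinv_def case_prod_beta')

lemma frechet_derivative_rinv: "frechet_derivative (rinv a b c) (at g) = (\<lambda>v. (0, 0, b \<bullet> fst v))"
proof -
  have "(rinv a b c has_derivative (\<lambda>v. (0, 0, b \<bullet> fst v))) (at g)"
    unfolding rinv_def by (auto intro!: derivative_eq_intros)
  then show ?thesis by (simp add: frechet_derivative_at[symmetric])
qed

lemma lie_bracket_rinv: "lie_bracket (rinv a b c) (rinv a' b' c') = rinv 0 0 (b' \<bullet> a - b \<bullet> a')"
  by (simp add: lie_bracket_def frechet_derivative_rinv) (simp add: rinv_def)

lemma subspace_heis_algebra: "subspace heis_algebra"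
proof -
  have "0 = rinv 0 0 0" "rinv a b c + rinv a' b' c' = rinv (a + a') (b + b') (c + c')"
    "r *\<^sub>R rinv a b c = rinv (r *\<^sub>R a) (r *\<^sub>R b) (r * c)"
    for a b :: "real ^ 'n::finite" and c a' b' c' r
    by (auto simp: rinv_def fun_eq_iff zero_prod_def inner_add_left algebra_simps)
  note rinv_closed = this
  show ?thesis
  proof (rule subspaceI)
    show "0 \<in> heis_algebra"
      using rinv_closed(1) unfolding heis_algebra_iff by blast
    show "W + W' \<in> heis_algebra" if "W \<in> heis_algebra" "W' \<in> heis_algebra" for W W' :: "'a vfield"
      using that unfolding heis_algebra_iff by (elim exE) (simp only: rinv_closed, blast)
    show "r *\<^sub>R W \<in> heis_algebra" if "W \<in> heis_algebra" for r and W :: "'a vfield"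
      using that unfolding heis_algebra_iff by (elim exE) (simp only: rinv_closed, blast)
  qed
qed

text \<open>
  In the bracket of \<open>V\<close> with \<open>W\<close>, the derivative of \<open>W\<close> is vertical, so only the derivative of \<open>V\<close>
  survives in the quotient.
\<close>

lemma hproj_derivation_of:
  assumes diff: "\<And>g. V differentiable at g" and A: "linear A" "\<And>g. hproj (V g) = A (hproj g)"
    and W: "W \<in> heis_algebra"
  shows "hproj (derivation_of V W g) = A (hproj (W g))"
proof -
  have "((\<lambda>g. hproj (V g)) has_derivative (\<lambda>v. hproj (frechet_derivative V (at g) v))) (at g)"
    by (rule bounded_linear.has_derivative[OF bounded_linear_hproj])
      (use diff frechet_derivative_works in blast)
  moreover have "((\<lambda>g. A (hproj g)) has_derivative (\<lambda>v. A (hproj v))) (at g)"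
    using A(1) by (intro bounded_linear_imp_has_derivative bounded_linear_compose[OF _ bounded_linear_hproj])
      (simp add: linear_conv_bounded_linear)
  ultimately have DV: "hproj (frechet_derivative V (at g) v) = A (hproj v)" for v
    unfolding A(2) by (metis has_derivative_unique)
  have DW: "hproj (frechet_derivative W (at g) v) = 0" for v
    using W by (auto simp: heis_algebra_iff frechet_derivative_rinv hproj_def zero_prod_def)
  then show ?thesis
    by (simp add: derivation_of_def lie_bracket_def DV
        linear_diff[OF bounded_linear.linear[OF bounded_linear_hproj]])
qed

text \<open>
  The right-invariant fields whose projection lies in the span \<open>M\<close> of the vectors \<open>A\<^sup>k b\<^sub>i\<close> form a Lie
  subalgebra, since brackets project to \<open>0\<close>. It contains all \<open>D\<^sup>k B\<^sub>i\<close>, so it is the whole algebra by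
  the rank condition, and every vector of the quotient is the projection of some right-invariant field.
\<close>

lemma rank_condition_imp_kalman:
  fixes V :: "'n::finite vfield"
  assumes rank: "rank_condition V I B"
    and diff: "\<And>g. V differentiable at g" and A: "linear A" "\<And>g. hproj (V g) = A (hproj g)"
  shows "span {(A ^^ k) (hproj (B i 0)) | k i. i \<in> I} = UNIV"
proof -
  define S where "S = {(derivation_of V ^^ k) (B i) | k i. i \<in> I}"
  define M where "M = span {(A ^^ k) (hproj (B i 0)) | k i. i \<in> I}"
  define L where "L = {W \<in> heis_algebra. hproj (W 0) \<in> M}"
  have hull: "lie_subalgebra hull S = heis_algebra"
    using rank by (simp add: rank_condition_def S_def)
  \<comment> \<open>The hull contains its generators, so it is the rank condition itself that makes the iterated
      derivations right-invariant.\<close>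
  have S_heis: "S \<subseteq> heis_algebra"
    using hull_subset[of S lie_subalgebra] by (simp only: hull)
  have proj: "hproj ((derivation_of V ^^ k) (B i) 0) = (A ^^ k) (hproj (B i 0))" if "i \<in> I" for k i
  proof (induction k)
    case (Suc k)
    have "(derivation_of V ^^ k) (B i) \<in> heis_algebra"
      using S_heis that unfolding S_def by blast
    then show ?case
      using Suc by (simp add: hproj_derivation_of[OF diff A])
  qed simp
  have lin: "linear hproj"
    by (rule bounded_linear.linear[OF bounded_linear_hproj])
  have "lie_subalgebra L"
    unfolding lie_subalgebra_def
  proof (intro conjI ballI)
    show "L \<subseteq> heis_algebra" by (auto simp: L_def)
    show "subspace L"
      using subspace_heis_algebra unfolding L_def M_def
      by (auto simp: subspace_def linear_0[OF lin] linear_add[OF lin] linear_scale[OF lin]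
          intro: span_zero span_add span_scale)
    fix W W' assume "W \<in> L" "W' \<in> L"
    then obtain c where bracket: "lie_bracket W W' = rinv 0 0 c"
      unfolding L_def heis_algebra_iff using lie_bracket_rinv by blast
    have "hproj (rinv 0 0 c (0 :: 'n heis)) = 0"
      by (simp add: rinv_def hproj_def zero_prod_def)
    then show "lie_bracket W W' \<in> L"
      using bracket by (auto simp: L_def M_def heis_algebra_iff intro: span_zero)
  qed
  moreover have "S \<subseteq> L"
    using S_heis proj unfolding S_def L_def M_def by (fastforce intro!: span_base)
  ultimately have "heis_algebra \<subseteq> L"
    using hull_minimal[of S L lie_subalgebra] by (simp add: hull)
  have "v \<in> M" for v
  proof -
    have "rinv (fst v) (snd v) 0 \<in> L"
      using \<open>heis_algebra \<subseteq> L\<close> heis_algebra_iff by blast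
    then show ?thesis by (simp add: L_def rinv_def hproj_def)
  qed
  then show ?thesis unfolding M_def by blast
qed

section \<open>Steering between fibres of the quotient\<close>

lemma trajectory_if_has_vector_derivative:
  assumes "\<And>t. t \<in> {0..T} \<Longrightarrow>
    (\<gamma> has_vector_derivative V (\<gamma> t) + (\<Sum>i\<in>I. u t i *\<^sub>R B i (\<gamma> t))) (at t within {0..T})"
  shows "trajectory V I B u T \<gamma>"
  unfolding trajectory_def
proof (intro conjI ballI)
  show "continuous_on {0..T} \<gamma>"
    using assms by (rule continuous_on_vector_derivative)
  fix t assume t: "t \<in> {0..T}"
  show "((\<lambda>s. V (\<gamma> s) + (\<Sum>i\<in>I. u s i *\<^sub>R B i (\<gamma> s))) has_integral (\<gamma> t - \<gamma> 0)) {0..t}"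
  proof (rule fundamental_theorem_of_calculus)
    show "(\<gamma> has_vector_derivative V (\<gamma> s) + (\<Sum>i\<in>I. u s i *\<^sub>R B i (\<gamma> s))) (at s within {0..t})"
      if "s \<in> {0..t}" for s
      using that t by (intro has_vector_derivative_within_subset[OF assms]) auto
  qed (use t in auto)
qed

lemma admissible_input_if_continuous:
  assumes "\<And>i. i \<in> I \<Longrightarrow> continuous_on UNIV (\<lambda>t. u t i)"
  shows "admissible_input I u"
  unfolding admissible_input_def
proof (intro ballI conjI allI)
  fix i assume "i \<in> I"
  then have "continuous_on S (\<lambda>t. u t i)" for S
    using assms continuous_on_subset by blast
  then show "(\<lambda>t. u t i) \<in> borel_measurable (lebesgue_on {0..})"
      and "bounded ((\<lambda>t. u t i) ` {0..T})" for T
    by (auto intro!: continuous_imp_measurable_on_sets_lebesgue compact_imp_bounded compact_continuous_image)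
qed

definition steers :: "'n::finite vfield \<Rightarrow> nat set \<Rightarrow> (nat \<Rightarrow> 'n vfield) \<Rightarrow> 'n heis \<Rightarrow> 'n heis \<Rightarrow> bool" where
  "steers V I B g h \<longleftrightarrow> (\<exists>T\<ge>0. \<exists>u \<gamma>.
     admissible_input I u \<and> trajectory V I B u T \<gamma> \<and> \<gamma> 0 = g \<and> \<gamma> T = h)"

lemma steersI:
  assumes "0 \<le> T" "admissible_input I u" "trajectory V I B u T \<gamma>" "\<gamma> 0 = g" "\<gamma> T = h"
  shows "steers V I B g h"
  unfolding steers_def using assms by blast

lemma steersE:
  assumes "steers V I B g h"
  obtains T u \<gamma> where "0 \<le> T" "admissible_input I u" "trajectory V I B u T \<gamma>" "\<gamma> 0 = g" "\<gamma> T = h"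
  using assms unfolding steers_def by blast

text \<open>
  One input steers the whole fibre over \<open>v\<close> onto the fibre over \<open>w\<close>: the horizontal motion does not
  see \<open>z\<close>, and along it the vertical coordinate obeys a scalar affine equation whose
  coefficient \<open>d\<close> comes from \<open>V\<close>, because right-invariant fields do not depend on \<open>z\<close>.
\<close>

lemma rank_condition_imp_steering_between_fibres:
  fixes V :: "'n::finite vfield"
  assumes sys: "linear_system V I B" and rank: "rank_condition V I B"
  obtains C d where "\<forall>z. steers V I B (hpoint v z) (hpoint w (exp d * (z + C)))"
proof -
  have fin: "finite I" and linV: "linear_vfield V" and B: "\<And>i. i \<in> I \<Longrightarrow> B i \<in> heis_algebra"
    using sys by (auto simp: linear_system_def)
  have smV: "smooth V" using linV by (simp add: linear_vfield_def)
  obtain A d \<Psi> where "linear A" "\<forall>g. hproj (V g) = A (hproj g)"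
    and "\<forall>v z. snd (snd (V (hpoint v z))) = snd (snd (V (hpoint v 0))) + d * z"
    and "\<forall>t. linear (\<Psi> t)" "\<forall>v. \<Psi> 0 v = v" "\<forall>s t v. \<Psi> (s + t) v = \<Psi> s (\<Psi> t v)"
    "\<forall>t v. ((\<lambda>t. \<Psi> t v) has_vector_derivative A (\<Psi> t v)) (at t)"
    by (rule linear_vfield_structure[OF linV])
  then have A: "linear A" "\<And>g. hproj (V g) = A (hproj g)"
    and zV: "\<And>v z. snd (snd (V (hpoint v z))) = snd (snd (V (hpoint v 0))) + d * z"
    and \<Psi>: "\<And>t. linear (\<Psi> t)" "\<And>v. \<Psi> 0 v = v" "\<And>s t v. \<Psi> (s + t) v = \<Psi> s (\<Psi> t v)"
    "\<And>t v. ((\<lambda>t. \<Psi> t v) has_vector_derivative A (\<Psi> t v)) (at t)"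
    by blast+
  obtain u x where u: "\<forall>i. continuous_on UNIV (\<lambda>t. u t i)" and x01: "x 0 = v" "x 1 = w"
    and x': "\<forall>t\<in>{0..1}.
      (x has_vector_derivative A (x t) + (\<Sum>i\<in>I. u t i *\<^sub>R hproj (B i 0))) (at t within {0..1})"
    by (rule kalman_steering[OF A(1) \<Psi> fin
          rank_condition_imp_kalman[OF rank smooth_imp_differentiable[OF smV] A]])
  have hB: "hproj (B i g) = hproj (B i 0)" and zB: "snd (snd (B i (hpoint y z))) = snd (snd (B i (hpoint y 0)))"
    and contB: "continuous_on S (B i)" if "i \<in> I" for i g y z S
  proof -
    obtain a b c where W: "B i = rinv a b c"
      using B[OF \<open>i \<in> I\<close>] by (auto simp: heis_algebra_iff)
    show "hproj (B i g) = hproj (B i 0)" by (simp add: W rinv_def hproj_def)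
    show "snd (snd (B i (hpoint y z))) = snd (snd (B i (hpoint y 0)))"
      by (simp add: W rinv_def hpoint_def)
    show "continuous_on S (B i)" unfolding W rinv_def by (intro continuous_intros)
  qed
  define F where "F t = snd (snd (V (hpoint (x t) 0))) + (\<Sum>i\<in>I. u t i * snd (snd (B i (hpoint (x t) 0))))" for t
  have cont_lift: "continuous_on {0..1} (\<lambda>t. hpoint (x t) 0)"
    unfolding hpoint_def using continuous_on_vector_derivative[OF x'[rule_format]] by (intro continuous_intros)
  have "continuous_on {0..1} F"
    unfolding F_def
    by (intro continuous_intros continuous_on_subset[OF u[rule_format]]
        continuous_on_compose2[OF smooth_imp_continuous[OF smV, of UNIV] cont_lift]
        continuous_on_compose2[OF contB[of _ UNIV] cont_lift]) auto
  then obtain C where C: "\<forall>z\<^sub>0. \<exists>z. z 0 = z\<^sub>0 \<and> z 1 = exp d * (z\<^sub>0 + C) \<and>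
    (\<forall>t\<in>{0..1}. (z has_vector_derivative d * z t + F t) (at t within {0..1}))"
    by (rule scalar_affine_ode)
  have lin: "linear hproj" "linear (\<lambda>g::'n heis. snd (snd g))"
    by (auto intro!: bounded_linear.linear bounded_linear_hproj
        bounded_linear_compose[OF bounded_linear_snd bounded_linear_snd])
  show ?thesis
  proof (intro that allI)
    fix z\<^sub>0 :: real
    obtain z where z01: "z 0 = z\<^sub>0" "z 1 = exp d * (z\<^sub>0 + C)"
      and z': "\<forall>t\<in>{0..1}. (z has_vector_derivative d * z t + F t) (at t within {0..1})"
      using C by blast
    define \<gamma> where "\<gamma> t = hpoint (x t) (z t)" for t
    have "trajectory V I B u 1 \<gamma>"
    proof (rule trajectory_if_has_vector_derivative)
      fix t :: real assume t: "t \<in> {0..1}"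
      let ?R = "V (\<gamma> t) + (\<Sum>i\<in>I. u t i *\<^sub>R B i (\<gamma> t))"
      have "hproj ?R = A (x t) + (\<Sum>i\<in>I. u t i *\<^sub>R hproj (B i 0))"
        by (simp add: linear_add[OF lin(1)] linear_sum[OF lin(1)] linear_scale[OF lin(1)]
            A(2) hB[of _ "hpoint (x t) (z t)"] \<gamma>_def)
      moreover have "snd (snd ?R) = d * z t + F t"
        using zV[of "x t" "z t"]
        by (simp add: linear_sum[OF lin(2)] \<gamma>_def zB[of _ "x t" "z t"] F_def)
      ultimately have R: "?R = hpoint (A (x t) + (\<Sum>i\<in>I. u t i *\<^sub>R hproj (B i 0))) (d * z t + F t)"
        using hpoint_hproj[of ?R] by simp
      show "(\<gamma> has_vector_derivative ?R) (at t within {0..1})"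
        unfolding R unfolding \<gamma>_def hpoint_def
        by (intro has_vector_derivative_Pair z'[rule_format, OF t]
            bounded_linear.has_vector_derivative[OF bounded_linear_fst x'[rule_format, OF t]]
            bounded_linear.has_vector_derivative[OF bounded_linear_snd x'[rule_format, OF t]])
    qed
    moreover have "admissible_input I u"
      using u by (intro admissible_input_if_continuous) blast
    moreover have "\<gamma> 0 = hpoint v z\<^sub>0" "\<gamma> 1 = hpoint w (exp d * (z\<^sub>0 + C))"
      by (simp_all add: \<gamma>_def x01 z01)
    ultimately show "steers V I B (hpoint v z\<^sub>0) (hpoint w (exp d * (z\<^sub>0 + C)))"
      by (intro steersI[OF zero_le_one])
  qed
qed

section \<open>Concatenation of trajectories\<close>

lemma controllable_onD:
  assumes "controllable_on M V I B" "g \<in> M" "h \<in> M"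
  shows "steers V I B g h"
proof -
  obtain T u \<gamma> where "T \<ge> 0" "admissible_input I u" "trajectory V I B u T \<gamma>" "\<gamma> 0 = g" "\<gamma> T = h"
    using assms(1)[unfolded controllable_on_def, rule_format, OF assms(2,3)] by (elim exE conjE)
  then show ?thesis by (rule steersI)
qed

lemma controllable_on_UNIV_iff: "controllable_on UNIV V I B \<longleftrightarrow> (\<forall>g h. steers V I B g h)"
  by (simp only: controllable_on_def steers_def ball_UNIV subset_UNIV simp_thms)

text \<open>
  Measurability is transferred to the whole line by extending the inputs by zero, where translations
  are measurable and gluing is a case distinction.
\<close>

lemma admissible_input_concat:
  assumes u: "admissible_input I u" and w: "admissible_input I w" and S: "S \<ge> 0"
  shows "admissible_input I (\<lambda>t. if t < S then u t else w (t - S))"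
  unfolding admissible_input_def
proof (intro ballI conjI allI)
  fix i assume i: "i \<in> I"
  define f where "f u = (\<lambda>t. if t \<in> {0..} then u t i else 0 :: real)" for u :: "real \<Rightarrow> nat \<Rightarrow> real"
  have f: "f u \<in> borel_measurable lebesgue" "f w \<in> borel_measurable lebesgue"
    using u w i unfolding f_def admissible_input_def by (intro borel_measurable_if_I; simp)+
  have "(\<lambda>t. t - S) \<in> lebesgue \<rightarrow>\<^sub>M lebesgue"
    using lebesgue_affine_measurable[of "\<lambda>_. 1 :: real" "- S"] by simp
  then have "(\<lambda>t. f w (t - S)) \<in> borel_measurable lebesgue"
    using f(2) by (rule measurable_compose)
  moreover have "{t \<in> space lebesgue. t < S} \<in> sets lebesgue"
    using sets_completionI_sets[of "{..<S}" lborel] by (simp add: lessThan_def)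
  ultimately have "(\<lambda>t. if t < S then f u t else f w (t - S)) \<in> borel_measurable lebesgue"
    using f by (intro measurable_If)
  also have "(\<lambda>t. if t < S then f u t else f w (t - S)) =
      (\<lambda>t. if t \<in> {0..} then (if t < S then u t else w (t - S)) i else 0)"
    using S by (auto simp: f_def fun_eq_iff)
  finally show "(\<lambda>t. (if t < S then u t else w (t - S)) i) \<in> borel_measurable (lebesgue_on {0..})"
    by (rule borel_measurable_if_D)
next
  fix i T assume "i \<in> I"
  then have "bounded ((\<lambda>t. u t i) ` {0..S} \<union> (\<lambda>t. w t i) ` {0..T - S})"
    using u w by (simp add: admissible_input_def)
  then show "bounded ((\<lambda>t. (if t < S then u t else w (t - S)) i) ` {0..T})"
    by (rule bounded_subset) auto
qed

lemma trajectory_concat: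
  assumes \<gamma>: "trajectory V I B u S \<gamma>" and \<delta>: "trajectory V I B w T \<delta>"
    and glue: "\<gamma> S = \<delta> 0" and S: "S \<ge> 0" and T: "T \<ge> 0"
  shows "trajectory V I B (\<lambda>t. if t < S then u t else w (t - S)) (S + T)
    (\<lambda>t. if t \<le> S then \<gamma> t else \<delta> (t - S))" (is "trajectory _ _ _ ?u _ ?c")
proof -
  let ?rhs = "\<lambda>u \<gamma> s. V (\<gamma> s) + (\<Sum>i\<in>I. u s i *\<^sub>R B i (\<gamma> s))"
  \<comment> \<open>At the switching time \<open>S\<close> the glued input already takes the value \<open>w 0\<close>, a null set for the first
      piece.\<close>
  have first: "(?rhs ?u ?c has_integral ?c t - ?c 0) {0..t}" if "t \<in> {0..S}" for t
  proof (rule has_integral_spike_finite[of "{S}"])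
    show "(?rhs u \<gamma> has_integral ?c t - ?c 0) {0..t}"
      using \<gamma> that S unfolding trajectory_def by simp
  qed (use that in auto)
  have second: "(?rhs ?u ?c has_integral ?c t - ?c S) {S..t}" if "t \<in> {S..S + T}" for t
  proof (rule has_integral_spike_finite[of "{}"])
    have "(?rhs w \<delta> has_integral \<delta> (t - S) - \<delta> 0) {0..t - S}"
      using \<delta> that unfolding trajectory_def by simp
    from has_integral_shift_real_ivl[OF this, of "- S"]
    show "((\<lambda>s. ?rhs w \<delta> (s - S)) has_integral ?c t - ?c S) {S..t}"
      using that glue by (cases "t = S") auto
  qed (use glue in auto)
  show ?thesis
    unfolding trajectory_def
  proof (intro conjI ballI)
    have "continuous_on {0..S} ?c"
      using \<gamma> unfolding trajectory_def by (auto intro: continuous_on_eq)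
    moreover have "continuous_on {S..S + T} ?c"
    proof -
      have "continuous_on {S..S + T} (\<lambda>t. \<delta> (t - S))"
        by (rule continuous_on_compose2[of "{0..T}" \<delta>])
          (use \<delta> in \<open>auto simp: trajectory_def intro!: continuous_intros\<close>)
      then show ?thesis
        by (rule continuous_on_eq) (use glue in auto)
    qed
    ultimately have "continuous_on ({0..S} \<union> {S..S + T}) ?c"
      by (intro continuous_on_closed_Un) auto
    then show "continuous_on {0..S + T} ?c"
      using S T by (simp add: ivl_disj_un_two_touch)
    fix t assume t: "t \<in> {0..S + T}"
    show "(?rhs ?u ?c has_integral ?c t - ?c 0) {0..t}"
    proof (cases "t \<le> S")
      case True
      then show ?thesis using first[of t] t by simp
    next
      case False
      have "(?rhs ?u ?c has_integral (?c S - ?c 0) + (?c t - ?c S)) {0..t}"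
        by (rule has_integral_combine[of 0 S t]) (use first[of S] second[of t] S t False in simp_all)
      moreover have "(?c S - ?c 0) + (?c t - ?c S) = ?c t - ?c 0"
        by (simp only: algebra_simps)
      ultimately show ?thesis by (simp only:)
    qed
  qed
qed

lemma steers_trans:
  assumes "steers V I B g h" "steers V I B h k"
  shows "steers V I B g k"
proof -
  obtain S u \<gamma> where 1: "S \<ge> 0" "admissible_input I u" "trajectory V I B u S \<gamma>" "\<gamma> 0 = g" "\<gamma> S = h"
    using assms(1) by (rule steersE)
  obtain T w \<delta> where 2: "T \<ge> 0" "admissible_input I w" "trajectory V I B w T \<delta>" "\<delta> 0 = h" "\<delta> T = k"
    using assms(2) by (rule steersE)
  define c where "c t = (if t \<le> S then \<gamma> t else \<delta> (t - S))" for t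
  show ?thesis
  proof (rule steersI)
    show "0 \<le> S + T" using 1 2 by simp
    show "admissible_input I (\<lambda>t. if t < S then u t else w (t - S))"
      using 1 2 by (intro admissible_input_concat)
    show "trajectory V I B (\<lambda>t. if t < S then u t else w (t - S)) (S + T) c"
      unfolding c_def using 1 2 by (intro trajectory_concat) simp_all
    show "c 0 = g" using 1 by (simp add: c_def)
    show "c (S + T) = k" using 1 2 by (cases "T = 0") (simp_all add: c_def)
  qed
qed

lemma steers_mono_inputs:
  assumes "steers V J B g h" "J \<subseteq> I" "finite I"
  shows "steers V I B g h"
proof -
  obtain T u \<gamma> where *: "T \<ge> 0" "admissible_input J u" "trajectory V J B u T \<gamma>" "\<gamma> 0 = g" "\<gamma> T = h"
    using assms(1) by (rule steersE)
  let ?u = "\<lambda>t i. if i \<in> J then u t i else 0"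
  have "(\<Sum>i\<in>I. ?u s i *\<^sub>R B i (\<gamma> s)) = (\<Sum>i\<in>J. u s i *\<^sub>R B i (\<gamma> s))" for s
    using assms(2,3) by (intro sum.mono_neutral_cong_right) auto
  then have "trajectory V I B ?u T \<gamma>"
    using *(3) by (simp add: trajectory_def)
  moreover have "admissible_input I ?u"
    using *(2) by (auto simp: admissible_input_def intro!: finite_imp_bounded finite_subset[of _ "{0}"])
  ultimately show ?thesis using * by (intro steersI)
qed

section \<open>Controllability through the center\<close>

text \<open>
  The central point \<open>(0, 0, z)\<close> is the exponential of the central field with constant value \<open>(0, 0, z)\<close>.
\<close>

lemma center_in_connected_subgroup:
  assumes "heis_center \<subseteq> L"
  shows "(0, 0, z) \<in> connected_subgroup (L :: 'n::finite vfield set)"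
proof -
  have "lie_bracket (rinv 0 0 z) W = 0" if "W \<in> heis_algebra" for W :: "'n vfield"
    using that by (auto simp: heis_algebra_iff lie_bracket_rinv) (simp add: rinv_def fun_eq_iff zero_prod_def)
  then have "rinv 0 0 z \<in> (heis_center :: 'n vfield set)"
    unfolding heis_center_def by (auto simp: heis_algebra_iff)
  moreover have "((\<lambda>t. (0, 0, t * z) :: 'n heis) has_vector_derivative rinv 0 0 z (0, 0, t * z)) (at t)" for t
    unfolding rinv_def by (auto intro!: derivative_eq_intros has_vector_derivative_Pair)
  ultimately have "(0, 0, z) \<in> exp_image L"
    unfolding exp_image_def using assms
    by (intro CollectI exI[of _ "\<lambda>t. (0, 0, t * z)"] exI[of _ "rinv 0 0 z"])
      (auto simp: heis_group_def zero_prod_def)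
  then show ?thesis
    unfolding connected_subgroup_def by (rule generate.incl)
qed

theorem theorem8:
  fixes V Z :: "'n::finite vfield"
    and B X Y :: "nat \<Rightarrow> 'n vfield"
    and m j :: nat
  assumes "linear_system V {1..m} B"
    and "inj_on B {1..m}" and "independent (B ` {1..m})"
    and "\<forall>i\<in>{1..m}. \<forall>k\<in>{1..m}. lie_bracket (B i) (B k) = 0"
    and "m \<le> CARD('n)"
    and "symplectic_basis X Y Z"
    and "\<forall>i\<in>{1..m}. X i = B i"
    and "rank_condition V {1..m} B"
    and "j \<in> {1..m}"
    and "decoupled_cell V (B j) (Y j) Z"
    and "controllable_on (connected_subgroup (span {B j, Y j, Z})) V {j} B"
  shows "controllable_on UNIV V {1..m} B"
proof -
  have sys: "linear_system V {1..m} B" and rank: "rank_condition V {1..m} B"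
    by fact+
  have "heis_center \<subseteq> span {B j, Y j, Z}"
    using \<open>symplectic_basis X Y Z\<close> span_mono[of "{Z}" "{B j, Y j, Z}"]
    by (simp add: symplectic_basis_def)
  then have fibre: "hpoint 0 z \<in> connected_subgroup (span {B j, Y j, Z})" for z
    using center_in_connected_subgroup by (simp add: hpoint_def)
  have "steers V {1..m} B g h" for g h
  proof -
    obtain C d where "\<forall>z. steers V {1..m} B (hpoint (hproj g) z) (hpoint 0 (exp d * (z + C)))"
      by (rule rank_condition_imp_steering_between_fibres[OF sys rank])
    from spec[OF this, of "snd (snd g)"]
    have down: "steers V {1..m} B g (hpoint 0 (exp d * (snd (snd g) + C)))"
      by (simp only: hpoint_hproj)
    obtain C' d' where up_all: "\<forall>z. steers V {1..m} B (hpoint 0 z) (hpoint (hproj h) (exp d' * (z + C')))"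
      by (rule rank_condition_imp_steering_between_fibres[OF sys rank])
    \<comment> \<open>The point of the center that the second transfer sends exactly to \<open>h\<close>.\<close>
    define z where "z = exp (- d') * snd (snd h) - C'"
    have "exp d' * (z + C') = snd (snd h)"
      by (simp add: z_def exp_minus)
    with spec[OF up_all, of z] have up: "steers V {1..m} B (hpoint 0 z) h"
      by (simp only: hpoint_hproj)
    have "steers V {j} B (hpoint 0 (exp d * (snd (snd g) + C))) (hpoint 0 z)"
      using controllable_onD[OF \<open>controllable_on (connected_subgroup (span {B j, Y j, Z})) V {j} B\<close> fibre fibre] .
    then have across: "steers V {1..m} B (hpoint 0 (exp d * (snd (snd g) + C))) (hpoint 0 z)"
      by (rule steers_mono_inputs) (use \<open>j \<in> {1..m}\<close> in simp_all)
    show ?thesis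
      by (rule steers_trans[OF steers_trans[OF down across] up])
  qed
  then show ?thesis
    unfolding controllable_on_UNIV_iff by blast
qed

end
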